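(* Let $W$ be a finite workload of queries, $\mathcal{I}$ a finite set of candidate indexes, and for each $q\in W$ let $c(q,\cdot)$ be a what-if cost function on subsets of $\mathcal{I}$ that is non-negative, monotone and submodular (as defined in the context). Run budget-aware two-phase greedy search on $W$ with at most $K$ indexes and a budget of $B$ what-if calls, maintaining the MCI upper bounds $u(q,z)$ by the two-phase update rule described in the context, and let $C_B^*$ be the configuration returned. Let $t<B$ be a time of this run (i.e., a moment, in Phase 1 or Phase 2, when $t$ what-if calls have been made), let $z'_1,\dots,z'_K$ be the indexes selected by the workload-level simulated greedy search at time $t$, and let $u^{(j)}(W,z'_j)$ be the value of $u(W,z'_j)=\sum_{q\in W}u(q,z'_j)$ used at step $j$ of that simulation. Then $$L(W, C_B^* )=c(W,\emptyset)-\sum_{j=1}^K u^{(j)}(W, z'_j)$$ is a lower bound of the what-if cost of $C_B^*$, i.e., $L(W,C_B^* )\le c(W,C_B^* )$.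
   Context: **Costs.** A configuration is a subset $C\subseteq\mathcal{I}$. The what-if cost $c(q,C)\ge 0$ is a real number, and $c(W,C)=\sum_{q\in W}c(q,C)$. Standing assumptions, for every $q\in W$: (Monotonicity) if $C_1\subseteq C_2$ then $c(q,C_2)\le c(q,C_1)$. (Submodularity) if $X\subseteq Y$ and $z\notin Y$ then $c(q,Y)-c(q,Y\cup\{z\})\le c(q,X)-c(q,X\cup\{z\})$. Write $\Delta(q,C)=c(q,\emptyset)-c(q,C)$ (cost improvement) and $\delta(q,z,C)=c(q,C)-c(q,C\cup\{z\})$ (marginal cost improvement, MCI). $\Omega_q$ denotes the best possible configuration for $q$ when all candidate indexes are available, so $c(q,\Omega_q)=\min_{C\subseteq\mathcal{I}}c(q,C)$. The values $c(q,\emptyset)$ and $c(q,\Omega_q)$ are known. **Budget-aware two-phase greedy search.** A what-if call on $(q,C)$ reveals $c(q,C)$; at most $B$ calls may be made overall, allocated on a first-come-first-serve basis. The cost $c(q,C)$ is *available* if a what-if call on $(q,C)$ has been made (or $C=\emptyset$); $c(W,C)$ is available if $c(q,C)$ is available for all $q\in W$. If no what-if call is made on $(q,C)$, its cost is approximated by the derived cost $d(q,C)=\min_{S\subseteq C}c(q,S)$, the minimum being over subsets $S$ of $C$ for which $c(q,S)$ is available. Greedy search over a set of candidates (for a given workload) starts from $C_0=\emptyset$; in step $i$ every not yet selected candidate $z$ is evaluated via the workload cost of $C_{i-1}\cup\{z\}$ (using what-if calls while budget remains, derived costs otherwise), the candidate $z_i$ giving the smallest workload cost is selected and $C_i=C_{i-1}\cup\{z_i\}$;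 it stops when $K$ indexes have been selected or no remaining candidate lowers the cost. In Phase 1, greedy search is run separately for each single query $q\in W$ over its candidate indexes; in Phase 2, greedy search is run for the whole workload $W$ over the union of the indexes found for the individual queries in Phase 1. $C_B^*$ is the result of Phase 2. **Two-phase update rule for MCI upper bounds.** For each index $z$ and query $q$: (a) initialize $u(q,z)=\min\{c(q,\emptyset),\Delta(q,\Omega_q)\}$. (b) In Phase 1, update $u(q,z)=\min\{c(q,\emptyset),\Delta(q,\Omega_q),\Delta(q,\{z\})\}$ once $c(q,\{z\})$ is available. (c) In Phase 2, during each greedy step $1\le k\le K$, update $u(q,z)=c(q,C_{k-1})-c(q,C_{k-1}\cup\{z\})=\delta(q,z,C_{k-1})$ if both $c(W,C_{k-1})$ and $c(q,C_{k-1}\cup\{z\})$ are available, where $C_k$ is the configuration selected by the Phase 2 greedy search in step $k$ ($C_0=\emptyset$) and $z$ has not been included in $C_k$. **Workload-level simulated greedy search at time $t$.** Let $u(W,z)=\sum_{q\in W}u(q,z)$. Using the values $u(q,z)$ current at the moment when $t$ what-if calls have been made (no further what-if calls are made, so these values do not change during the simulation), start from the empty configuration and repeatedly, at step $j$, select from the candidate indexes in $\mathcal{I}$ not yet chosen by the simulation the index $z'_j$ with the maximum value $u^{(j)}(W,z'_j)$ of $u(W,\cdot)$, provided this value is $>0$; stop after $K$ indexes or when no remaining index has positive value. If only $l<K$ indexes are selected, all remaining indexes have $u(W,z)=0$, and by convention the terms $u^{(j)}(W,z'_j)$ with $l<j\le K$ are $0$. *)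

theory Defs
  imports Complex_Main
begin

text \<open>
  Queries have type \<^typ>\<open>'q\<close> and indexes type \<^typ>\<open>'i\<close>; configurations are sets of indexes and
  \<open>c q C\<close> is the what-if cost of query \<open>q\<close> under configuration \<open>C\<close>.
\<close>

definition workload_cost :: "('q \<Rightarrow> 'i set \<Rightarrow> real) \<Rightarrow> 'q set \<Rightarrow> 'i set \<Rightarrow> real" where
  "workload_cost c W C = (\<Sum>q\<in>W. c q C)"

definition cost_improvement :: "('q \<Rightarrow> 'i set \<Rightarrow> real) \<Rightarrow> 'q \<Rightarrow> 'i set \<Rightarrow> real" where
  "cost_improvement c q C = c q {} - c q C"

definition marginal_improvement :: "('q \<Rightarrow> 'i set \<Rightarrow> real) \<Rightarrow> 'q \<Rightarrow> 'i \<Rightarrow> 'i set \<Rightarrow> real" where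
  "marginal_improvement c q z C = c q C - c q (C \<union> {z})"

text \<open>\<open>\<Omega>\<^sub>q\<close>: some cost-minimal configuration; only its cost is ever used.\<close>

definition best_configuration :: "'i set \<Rightarrow> ('q \<Rightarrow> 'i set \<Rightarrow> real) \<Rightarrow> 'q \<Rightarrow> 'i set" where
  "best_configuration I c q = arg_min_on (c q) (Pow I)"


text \<open>
  \<open>A\<close> is the set of pairs \<open>(q, C)\<close> on which a what-if call has been made. The costs \<open>c q {}\<close> are
  available without a call.
\<close>

definition available :: "('q \<times> 'i set) set \<Rightarrow> 'q \<Rightarrow> 'i set \<Rightarrow> bool" where
  "available A q C \<longleftrightarrow> C = {} \<or> (q, C) \<in> A"

definition workload_available :: "('q \<times> 'i set) set \<Rightarrow> 'q set \<Rightarrow> 'i set \<Rightarrow> bool" where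
  "workload_available A W C \<longleftrightarrow> (\<forall>q\<in>W. available A q C)"

definition derived_cost ::
    "('q \<Rightarrow> 'i set \<Rightarrow> real) \<Rightarrow> ('q \<times> 'i set) set \<Rightarrow> 'q \<Rightarrow> 'i set \<Rightarrow> real" where
  "derived_cost c A q C = Min {c q S |S. S \<subseteq> C \<and> available A q S}"

definition estimated_cost ::
    "('q \<Rightarrow> 'i set \<Rightarrow> real) \<Rightarrow> ('q \<times> 'i set) set \<Rightarrow> 'q \<Rightarrow> 'i set \<Rightarrow> real" where
  "estimated_cost c A q C = (if available A q C then c q C else derived_cost c A q C)"

definition initial_bound ::
    "'i set \<Rightarrow> ('q \<Rightarrow> 'i set \<Rightarrow> real) \<Rightarrow> 'q \<Rightarrow> 'i \<Rightarrow> real" where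
  "initial_bound I c q z = Min {c q {}, cost_improvement c q (best_configuration I c q)}"

definition phase1_update ::
    "'i set \<Rightarrow> ('q \<Rightarrow> 'i set \<Rightarrow> real) \<Rightarrow> ('q \<times> 'i set) set
      \<Rightarrow> ('q \<Rightarrow> 'i \<Rightarrow> real) \<Rightarrow> 'q \<Rightarrow> 'i \<Rightarrow> real" where
  "phase1_update I c A u q z =
     (if available A q {z}
      then Min {c q {}, cost_improvement c q (best_configuration I c q), cost_improvement c q {z}}
      else u q z)"

text \<open>
  Here \<open>C\<close> is the configuration selected so far, that is \<open>C\<^bsub>k-1\<^esub>\<close> during greedy step
  \<open>k = card C + 1\<close>. As the new member of \<open>C\<^sub>k\<close> is determined only at the end of step \<open>k\<close>, an index
  that has not (yet) been included in \<open>C\<^sub>k\<close> is one outside \<open>C\<close>. There is no greedy step with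
  \<open>k > K\<close>.
\<close>

definition phase2_update ::
    "'q set \<Rightarrow> ('q \<Rightarrow> 'i set \<Rightarrow> real) \<Rightarrow> nat \<Rightarrow> ('q \<times> 'i set) set \<Rightarrow> 'i set
      \<Rightarrow> ('q \<Rightarrow> 'i \<Rightarrow> real) \<Rightarrow> 'q \<Rightarrow> 'i \<Rightarrow> real" where
  "phase2_update W c K A C u q z =
     (if card C < K \<and> z \<notin> C \<and> workload_available A W C \<and> available A q (C \<union> {z})
      then marginal_improvement c q z C
      else u q z)"


text \<open>
  A state of the two-phase search. In \<open>Between_Queries\<close> no greedy search is active (Phase 1 is about
  to start the search for another query, or is over); \<open>Query_Search q\<close> is the Phase 1 search for
  \<open>q\<close>; \<open>Workload_Search\<close> is Phase 2.
  \<^item> \<open>todo\<close>: queries whose Phase 1 search has not been started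
  \<^item> \<open>pool\<close>: indexes found by the completed Phase 1 searches
  \<^item> \<open>conf\<close>: configuration selected so far by the active greedy search; the result once \<open>Finished\<close>
  \<^item> \<open>calls\<close>: what-if calls made so far; none is ever repeated, so \<open>card calls\<close> counts them
  \<^item> \<open>bound\<close>: current upper bounds \<open>u(q, z)\<close>
\<close>

datatype 'q stage = Between_Queries | Query_Search 'q | Workload_Search | Finished

record ('q, 'i) search_state =
  stage :: "'q stage"
  todo :: "'q set"
  pool :: "'i set"
  conf :: "'i set"
  calls :: "('q \<times> 'i set) set"
  bound :: "'q \<Rightarrow> 'i \<Rightarrow> real"

definition initial_state ::
    "'q set \<Rightarrow> 'i set \<Rightarrow> ('q \<Rightarrow> 'i set \<Rightarrow> real) \<Rightarrow> ('q, 'i) search_state" where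
  "initial_state W I c =
     \<lparr> stage = Between_Queries, todo = W, pool = {}, conf = {}, calls = {},
       bound = initial_bound I c \<rparr>"

definition scope :: "'q set \<Rightarrow> ('q, 'i) search_state \<Rightarrow> 'q set" where
  "scope W s = (case stage s of
       Query_Search q \<Rightarrow> {q} | Workload_Search \<Rightarrow> W | _ \<Rightarrow> {})"

definition remaining :: "('q \<Rightarrow> 'i set) \<Rightarrow> ('q, 'i) search_state \<Rightarrow> 'i set" where
  "remaining cand s = (case stage s of
       Query_Search q \<Rightarrow> cand q | Workload_Search \<Rightarrow> pool s | _ \<Rightarrow> {}) - conf s"

definition scope_cost ::
    "'q set \<Rightarrow> ('q \<Rightarrow> 'i set \<Rightarrow> real) \<Rightarrow> ('q, 'i) search_state \<Rightarrow> 'i set \<Rightarrow> real" where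
  "scope_cost W c s C = (\<Sum>q\<in>scope W s. estimated_cost c (calls s) q C)"

definition update_bounds ::
    "'q set \<Rightarrow> 'i set \<Rightarrow> ('q \<Rightarrow> 'i set \<Rightarrow> real) \<Rightarrow> nat
      \<Rightarrow> ('q, 'i) search_state \<Rightarrow> ('q, 'i) search_state" where
  "update_bounds W I c K s = (case stage s of
       Query_Search q \<Rightarrow> s\<lparr> bound := phase1_update I c (calls s) (bound s) \<rparr>
     | Workload_Search \<Rightarrow> s\<lparr> bound := phase2_update W c K (calls s) (conf s) (bound s) \<rparr>
     | _ \<Rightarrow> s)"

text \<open>
  All candidates of the current greedy step have been evaluated: every cost involved is available,
  or the budget is exhausted (so that the rest is estimated by derived costs).
\<close>

definition evaluated ::
    "'q set \<Rightarrow> ('q \<Rightarrow> 'i set) \<Rightarrow> nat \<Rightarrow> ('q, 'i) search_state \<Rightarrow> bool" where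
  "evaluated W cand B s \<longleftrightarrow>
     card (calls s) \<ge> B \<or>
     (\<forall>z\<in>remaining cand s. workload_available (calls s) (scope W s) (conf s \<union> {z}))"

definition search_stops ::
    "'q set \<Rightarrow> ('q \<Rightarrow> 'i set) \<Rightarrow> ('q \<Rightarrow> 'i set \<Rightarrow> real) \<Rightarrow> nat \<Rightarrow> nat
      \<Rightarrow> ('q, 'i) search_state \<Rightarrow> bool" where
  "search_stops W cand c K B s \<longleftrightarrow>
     card (conf s) = K \<or>
     (evaluated W cand B s \<and>
      (\<forall>z\<in>remaining cand s. \<not> scope_cost W c s (conf s \<union> {z}) < scope_cost W c s (conf s)))"

text \<open>
  One transition of the two-phase search with candidate sets \<open>cand q\<close>, at most \<open>K\<close> indexes and a
  budget of \<open>B\<close> calls. The order of the queries in Phase 1, the order of the evaluations within a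
  greedy step, and the resolution of ties are left open.
\<close>

inductive search_step ::
    "'q set \<Rightarrow> 'i set \<Rightarrow> ('q \<Rightarrow> 'i set) \<Rightarrow> ('q \<Rightarrow> 'i set \<Rightarrow> real) \<Rightarrow> nat \<Rightarrow> nat
      \<Rightarrow> ('q, 'i) search_state \<Rightarrow> ('q, 'i) search_state \<Rightarrow> bool"
  for W I cand c K B where
  start_query:
    "search_step W I cand c K B s
       (s\<lparr> stage := Query_Search q, todo := todo s - {q}, conf := {} \<rparr>)"
    if "stage s = Between_Queries" "q \<in> todo s"
| what_if_call:
    "search_step W I cand c K B s
       (update_bounds W I c K (s\<lparr> calls := insert (q, conf s \<union> {z}) (calls s) \<rparr>))"
    if "card (conf s) < K" "z \<in> remaining cand s" "q \<in> scope W s"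
       "\<not> available (calls s) q (conf s \<union> {z})" "card (calls s) < B"
| select:
    "search_step W I cand c K B s
       (update_bounds W I c K (s\<lparr> conf := conf s \<union> {z} \<rparr>))"
    if "card (conf s) < K" "evaluated W cand B s" "z \<in> remaining cand s"
       "\<forall>z'\<in>remaining cand s. scope_cost W c s (conf s \<union> {z}) \<le> scope_cost W c s (conf s \<union> {z'})"
       "scope_cost W c s (conf s \<union> {z}) < scope_cost W c s (conf s)"
| finish_query:
    "search_step W I cand c K B s
       (s\<lparr> stage := Between_Queries, pool := pool s \<union> conf s, conf := {} \<rparr>)"
    if "stage s = Query_Search q" "search_stops W cand c K B s"
| start_workload:
    "search_step W I cand c K B s
       (update_bounds W I c K (s\<lparr> stage := Workload_Search, conf := {} \<rparr>))"
    if "stage s = Between_Queries" "todo s = {}"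
| finish_workload:
    "search_step W I cand c K B s (s\<lparr> stage := Finished \<rparr>)"
    if "stage s = Workload_Search" "search_stops W cand c K B s"


definition workload_bound :: "'q set \<Rightarrow> ('q \<Rightarrow> 'i \<Rightarrow> real) \<Rightarrow> 'i \<Rightarrow> real" where
  "workload_bound W u z = (\<Sum>q\<in>W. u q z)"

text \<open>\<open>simulation W I K u zs\<close>: the simulated greedy search can select \<open>zs\<close> in its first \<open>length zs\<close> steps.\<close>

inductive simulation ::
    "'q set \<Rightarrow> 'i set \<Rightarrow> nat \<Rightarrow> ('q \<Rightarrow> 'i \<Rightarrow> real) \<Rightarrow> 'i list \<Rightarrow> bool"
  for W I K u where
  empty: "simulation W I K u []"
| extend: "simulation W I K u (zs @ [z])"
    if "simulation W I K u zs" "length zs < K" "z \<in> I - set zs"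
       "\<forall>z'\<in>I - set zs. workload_bound W u z' \<le> workload_bound W u z"
       "workload_bound W u z > 0"

definition complete_simulation ::
    "'q set \<Rightarrow> 'i set \<Rightarrow> nat \<Rightarrow> ('q \<Rightarrow> 'i \<Rightarrow> real) \<Rightarrow> 'i list \<Rightarrow> bool" where
  "complete_simulation W I K u zs \<longleftrightarrow>
     simulation W I K u zs \<and>
     (length zs = K \<or> (\<forall>z\<in>I - set zs. \<not> workload_bound W u z > 0))"

text \<open>The value used at step \<open>j\<close> (steps count from 1, list positions from 0), or 0 past the last step.\<close>

definition simulation_value ::
    "'q set \<Rightarrow> ('q \<Rightarrow> 'i \<Rightarrow> real) \<Rightarrow> 'i list \<Rightarrow> nat \<Rightarrow> real" where
  "simulation_value W u zs j = (if j \<le> length zs then workload_bound W u (zs ! (j - 1)) else 0)"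

definition cost_lower_bound ::
    "'q set \<Rightarrow> ('q \<Rightarrow> 'i set \<Rightarrow> real) \<Rightarrow> nat \<Rightarrow> ('q \<Rightarrow> 'i \<Rightarrow> real) \<Rightarrow> 'i list \<Rightarrow> real" where
  "cost_lower_bound W c K u zs = workload_cost c W {} - (\<Sum>j=1..K. simulation_value W u zs j)"

end

(*
  Along the run of Phase 2 every selected index z satisfies u(q,z) \<ge> \<delta>(q,z,C), where C is the
  configuration to which z is added: u(q,z) always is at least the marginal improvement of z at an
  earlier configuration (or at the empty one), and marginal improvements shrink along the run by
  submodularity. Once z has been selected, u(q,z) is frozen, so telescoping bounds the improvement
  of the configuration reached at time t by the sum of the bounds of its members. The indexes that
  are added after time t are treated by submodularity at the configuration of time t. Hence the
  total improvement of the final configuration is at most the sum of u(W,z) over its at most K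
  members, and the simulated search picks the K largest of these values.
*)
theory Submission
  imports Defs
begin

section \<open>The simulated greedy search maximizes the total bound\<close>

lemma simulation_distinct_subset:
  assumes "simulation W I K u zs"
  shows "distinct zs" "set zs \<subseteq> I" "length zs \<le> K"
  using assms by (induction; auto)+

lemma simulation_pos:
  assumes "simulation W I K u zs" "z \<in> set zs"
  shows "workload_bound W u z > 0"
  using assms by induction auto

lemma simulation_dominates:
  assumes "simulation W I K u zs" "z \<in> set zs" "z' \<in> I - set zs"
  shows "workload_bound W u z' \<le> workload_bound W u z"
  using assms by induction auto

text \<open>The common part of \<open>A\<close> and \<open>B\<close> cancels, and
  \<open>A - B\<close> has at most as many elements as \<open>B - A\<close>. If \<open>A - B\<close>
  is nonempty, its largest value is a threshold below all values on \<open>B\<close>.\<close>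

lemma sum_le_sum_of_dominating_set:
  fixes f :: "'a \<Rightarrow> real"
  assumes "finite A" "finite B" "card A \<le> card B"
    and dom: "\<And>a b. a \<in> A - B \<Longrightarrow> b \<in> B \<Longrightarrow> f a \<le> f b"
    and nonneg: "\<And>b. b \<in> B \<Longrightarrow> 0 \<le> f b"
  shows "sum f A \<le> sum f B"
proof -
  have "sum f (A - B) \<le> sum f (B - A)"
  proof (cases "A \<subseteq> B")
    case True
    then have "A - B = {}" by blast
    then have "sum f (A - B) = 0" by (metis sum.empty)
    moreover have "0 \<le> sum f (B - A)"
      using nonneg by (intro sum_nonneg) auto
    ultimately show ?thesis by simp
  next
    case False
    define m where "m = Max (f ` (A - B))"
    have ne: "finite (f ` (A - B))" "f ` (A - B) \<noteq> {}"
      using False assms(1) by auto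
    have card_le: "card (A - B) \<le> card (B - A)"
      using card_le_sym_Diff[OF assms(1,2,3)] .
    have upper: "f a \<le> m" if "a \<in> A - B" for a
      using that ne by (auto simp: m_def)
    have lower: "m \<le> f b" if "b \<in> B" for b
      using Max_in[OF ne] dom that unfolding m_def by force
    \<comment> \<open>Passing to the larger cardinality needs a nonnegative factor, so the threshold
      is cut off at 0; \<open>max m 0\<close> still lies below the values on \<open>B\<close>, which
      are nonnegative.\<close>
    have "sum f (A - B) \<le> real (card (A - B)) * max m 0"
      using sum_bounded_above[of "A - B" f "max m 0"] upper by (simp add: le_max_iff_disj)
    also have "\<dots> \<le> real (card (B - A)) * max m 0"
      using card_le by (intro mult_right_mono) auto
    also have "\<dots> \<le> sum f (B - A)"
      using sum_bounded_below[of "B - A" "max m 0" f] lower nonneg by simp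
    finally show ?thesis .
  qed
  moreover have "sum f A = sum f (A \<inter> B) + sum f (A - B)"
    using assms(1) by (rule sum.Int_Diff)
  moreover have "sum f B = sum f (A \<inter> B) + sum f (B - A)"
    using sum.Int_Diff[OF assms(2), of f A] by (simp add: Int_commute)
  ultimately show ?thesis by simp
qed

text \<open>With \<open>K\<close> indexes chosen, these dominate any competing set of at most
  \<open>K\<close> indexes. Stopping for lack of positive values leaves only nonpositive ones
  outside, so discarding these from \<open>C\<close> cannot lower the sum.\<close>

lemma complete_simulation_maximal:
  assumes sim: "complete_simulation W I K u zs" and "finite I"
    and C: "C \<subseteq> I" "card C \<le> K"
  shows "sum (workload_bound W u) C \<le> sum (workload_bound W u) (set zs)"
proof -
  have s: "simulation W I K u zs"
    and stop: "length zs = K \<or> (\<forall>z\<in>I - set zs. \<not> workload_bound W u z > 0)"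
    using sim by (auto simp: complete_simulation_def)
  have fin: "finite C"
    using C assms(2) finite_subset by blast
  have pos: "\<And>z. z \<in> set zs \<Longrightarrow> 0 \<le> workload_bound W u z"
    using simulation_pos[OF s] by (simp add: less_imp_le)
  from stop show ?thesis
  proof
    assume "length zs = K"
    then have "card C \<le> card (set zs)"
      using C simulation_distinct_subset(1)[OF s] by (simp add: distinct_card)
    then show ?thesis
      using simulation_dominates[OF s] pos fin C
      by (intro sum_le_sum_of_dominating_set) auto
  next
    assume none: "\<forall>z\<in>I - set zs. \<not> workload_bound W u z > 0"
    have "sum (workload_bound W u) C \<le> sum (workload_bound W u) (C \<inter> set zs)"
      using sum.Int_Diff[OF fin, of "workload_bound W u" "set zs"] none C
        sum_nonpos[of "C - set zs" "workload_bound W u"] by force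
    also have "\<dots> \<le> sum (workload_bound W u) (set zs)"
      using pos by (intro sum_mono2) auto
    finally show ?thesis .
  qed
qed

lemma sum_simulation_value:
  assumes "simulation W I K u zs"
  shows "(\<Sum>j=1..K. simulation_value W u zs j) = sum (workload_bound W u) (set zs)"
proof -
  note zs = simulation_distinct_subset[OF assms]
  have "(\<Sum>j=1..K. simulation_value W u zs j) = (\<Sum>j=1..length zs. simulation_value W u zs j)"
    using zs(3) by (intro sum.mono_neutral_right) (auto simp: simulation_value_def)
  also have "\<dots> = (\<Sum>i<length zs. workload_bound W u (zs ! i))"
    \<comment> \<open>Steps count from 1 and list positions from 0, hence the shift by
      \<open>Suc\<close>.\<close>
    by (rule sum.reindex_bij_witness[of _ Suc "\<lambda>j. j - 1"]) (auto simp: simulation_value_def)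
  also have "\<dots> = sum (workload_bound W u) (set zs)"
    using zs(1) by (simp add: atLeast0LessThan interv_sum_list_conv_sum_set_nat sum_list_sum_nth
        flip: sum_list_distinct_conv_sum_set)
  finally show ?thesis .
qed

section \<open>Submodular cost functions and valid bounds\<close>

locale what_if_costs =
  fixes W :: "'q set" and I :: "'i set" and c :: "'q \<Rightarrow> 'i set \<Rightarrow> real"
  assumes finite_I: "finite I"
    and nonneg: "\<And>q C. q \<in> W \<Longrightarrow> C \<subseteq> I \<Longrightarrow> 0 \<le> c q C"
    and monotone: "\<And>q C1 C2. q \<in> W \<Longrightarrow> C1 \<subseteq> C2 \<Longrightarrow> C2 \<subseteq> I \<Longrightarrow> c q C2 \<le> c q C1"
    and submodular: "\<And>q X Y z. q \<in> W \<Longrightarrow> X \<subseteq> Y \<Longrightarrow> Y \<subseteq> I \<Longrightarrow> z \<in> I \<Longrightarrow> z \<notin> Y \<Longrightarrow>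
           c q Y - c q (Y \<union> {z}) \<le> c q X - c q (X \<union> {z})"
begin

lemma marginal_improvement_nonneg:
  "q \<in> W \<Longrightarrow> C \<subseteq> I \<Longrightarrow> z \<in> I \<Longrightarrow> 0 \<le> marginal_improvement c q z C"
  using monotone[of q C "insert z C"] by (simp add: marginal_improvement_def subset_insertI)

lemma marginal_improvement_antimono:
  "q \<in> W \<Longrightarrow> X \<subseteq> Y \<Longrightarrow> Y \<subseteq> I \<Longrightarrow> z \<in> I \<Longrightarrow> z \<notin> Y \<Longrightarrow>
     marginal_improvement c q z Y \<le> marginal_improvement c q z X"
  using submodular by (simp add: marginal_improvement_def)

text \<open>Adding \<open>A\<close> one index at a time telescopes the left side; by submodularity
  each index gains at its intermediate configuration at most what it gains at
  \<open>D\<close>.\<close>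

lemma improvement_le_sum_marginal:
  assumes "q \<in> W" "D \<union> A \<subseteq> I" "D \<inter> A = {}"
  shows "c q D - c q (D \<union> A) \<le> (\<Sum>z\<in>A. marginal_improvement c q z D)"
proof -
  have "finite A"
    using assms finite_I finite_subset by blast
  then show ?thesis
    using assms
  proof (induction A)
    case (insert z A)
    have "marginal_improvement c q z (D \<union> A) \<le> marginal_improvement c q z D"
      using insert by (intro marginal_improvement_antimono) auto
    then show ?case
      using insert by (simp add: marginal_improvement_def)
  qed simp
qed

lemma best_configuration_le:
  assumes "C \<subseteq> I"
  shows "c q (best_configuration I c q) \<le> c q C"
  unfolding best_configuration_def
  using assms finite_I by (intro arg_min_least) auto

lemma marginal_empty_le_improvement_best:
  assumes "z \<in> I"
  shows "marginal_improvement c q z {} \<le> cost_improvement c q (best_configuration I c q)"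
  using best_configuration_le[of "{z}" q] assms
  by (simp add: marginal_improvement_def cost_improvement_def)

lemma marginal_empty_le_cost:
  assumes "q \<in> W" "z \<in> I"
  shows "marginal_improvement c q z {} \<le> c q {}"
  using nonneg[of q "{z}"] assms by (simp add: marginal_improvement_def)

text \<open>The invariant of the run, with \<open>D\<close> the Phase 2 configuration so far. Bounds
  of members of \<open>D\<close> refer to earlier configurations and are controlled only through
  their sum; those outside are compared one by one with the gains at \<open>D\<close>.\<close>

definition valid_bounds :: "'i set \<Rightarrow> ('q \<Rightarrow> 'i \<Rightarrow> real) \<Rightarrow> bool" where
  "valid_bounds D u \<longleftrightarrow> (\<forall>q\<in>W.
     c q {} - c q D \<le> (\<Sum>z\<in>D. u q z) \<and>
     (\<forall>z\<in>I. 0 \<le> u q z) \<and> (\<forall>z\<in>I - D. marginal_improvement c q z D \<le> u q z))"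

text \<open>For the empty configuration the sum clause reads 0 \<le> 0, and nonnegativity is
  inherited from the marginal improvements.\<close>

lemma valid_bounds_empty_iff:
  "valid_bounds {} u \<longleftrightarrow> (\<forall>q\<in>W. \<forall>z\<in>I. marginal_improvement c q z {} \<le> u q z)"
  unfolding valid_bounds_def by (auto intro: order_trans[OF marginal_improvement_nonneg[of _ "{}"]])

lemma valid_bounds_initial: "valid_bounds {} (initial_bound I c)"
  by (auto simp: valid_bounds_empty_iff initial_bound_def
      marginal_empty_le_cost marginal_empty_le_improvement_best)

text \<open>The new term \<open>cost_improvement c q {z}\<close> coincides with the marginal
  improvement of \<open>z\<close> at the empty configuration, and the other two terms are no
  smaller.\<close>

lemma valid_bounds_phase1_update:
  assumes "valid_bounds {} u"
  shows "valid_bounds {} (phase1_update I c A u)"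
  using assms marginal_empty_le_cost marginal_empty_le_improvement_best
  by (auto simp: valid_bounds_empty_iff phase1_update_def)
     (auto simp: marginal_improvement_def cost_improvement_def)

text \<open>An update touches only indexes outside \<open>D\<close> and installs the marginal
  improvement at \<open>D\<close>, the least value the invariant permits there.\<close>

lemma valid_bounds_phase2_update:
  assumes "valid_bounds D u" "D \<subseteq> I"
  shows "valid_bounds D (phase2_update W c K A D u)"
proof -
  have "(\<Sum>z\<in>D. phase2_update W c K A D u q z) = (\<Sum>z\<in>D. u q z)" for q
    by (intro sum.cong) (auto simp: phase2_update_def)
  then show ?thesis
    using assms marginal_improvement_nonneg[of _ D]
    by (auto simp: valid_bounds_def phase2_update_def)
qed

text \<open>The same \<open>u\<close> survives a selection: the bound of \<open>z\<close> covers its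
  gain at \<open>D\<close>, which extends the telescoped sum, and the gains of the other indexes
  only shrink.\<close>

lemma valid_bounds_insert:
  assumes valid: "valid_bounds D u" and "D \<subseteq> I" "z \<in> I" "z \<notin> D"
  shows "valid_bounds (D \<union> {z}) u"
  unfolding valid_bounds_def
proof (intro ballI conjI)
  fix q assume q: "q \<in> W"
  have "finite D"
    using assms(2) finite_I finite_subset by blast
  moreover have "marginal_improvement c q z D \<le> u q z"
    using assms q by (auto simp: valid_bounds_def)
  moreover have "c q {} - c q D \<le> (\<Sum>z\<in>D. u q z)"
    using valid q by (auto simp: valid_bounds_def)
  ultimately show "c q {} - c q (D \<union> {z}) \<le> (\<Sum>z\<in>D \<union> {z}. u q z)"
    using assms(4) by (simp add: marginal_improvement_def)
next
  fix q z' assume "q \<in> W" "z' \<in> I"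
  then show "0 \<le> u q z'"
    using valid by (auto simp: valid_bounds_def)
next
  fix q z' assume "q \<in> W" "z' \<in> I - (D \<union> {z})"
  moreover from this have "marginal_improvement c q z' D \<le> u q z'"
    using valid by (auto simp: valid_bounds_def)
  ultimately show "marginal_improvement c q z' (D \<union> {z}) \<le> u q z'"
    using assms marginal_improvement_antimono[of q D "D \<union> {z}" z'] by (auto simp: subset_insertI)
qed

text \<open>Here \<open>E\<close> plays the final configuration. The gain up to \<open>D\<close> is
  covered by the sum clause, the rest by the marginal improvements at \<open>D\<close>, so the
  bounds held at \<open>D\<close> suffice for both.\<close>

lemma valid_bounds_improvement_le:
  assumes valid: "valid_bounds D u" and "D \<subseteq> E" "E \<subseteq> I" "q \<in> W"
  shows "c q {} - c q E \<le> (\<Sum>z\<in>E. u q z)"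
proof -
  have E: "E = D \<union> (E - D)"
    using assms(2) by blast
  have fin: "finite E"
    using assms(3) finite_I finite_subset by blast
  have "c q {} - c q D \<le> (\<Sum>z\<in>D. u q z)"
    using valid assms(4) by (auto simp: valid_bounds_def)
  moreover have "c q D - c q E \<le> (\<Sum>z\<in>E - D. marginal_improvement c q z D)"
    using improvement_le_sum_marginal[of q D "E - D"] assms E by auto
  moreover have "\<dots> \<le> (\<Sum>z\<in>E - D. u q z)"
    using valid assms by (intro sum_mono) (auto simp: valid_bounds_def)
  moreover have "(\<Sum>z\<in>E. u q z) = (\<Sum>z\<in>E - D. u q z) + (\<Sum>z\<in>D. u q z)"
    using sum.subset_diff[OF assms(2) fin] .
  ultimately show ?thesis by linarith
qed

end

section \<open>Invariants of the two-phase search\<close>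

text \<open>Phase 1 configurations do not contribute to the result, hence the empty set before Phase 2.\<close>

definition settled :: "('q, 'i) search_state \<Rightarrow> 'i set" where
  "settled s = (case stage s of Workload_Search \<Rightarrow> conf s | Finished \<Rightarrow> conf s | _ \<Rightarrow> {})"

lemma update_bounds_simps [simp]:
  "stage (update_bounds W I c K s) = stage s"
  "todo (update_bounds W I c K s) = todo s"
  "pool (update_bounds W I c K s) = pool s"
  "conf (update_bounds W I c K s) = conf s"
  by (auto simp: update_bounds_def split: stage.split)

lemma settled_update_bounds [simp]: "settled (update_bounds W I c K s) = settled s"
  by (simp add: settled_def split: stage.split)

text \<open>Resets of \<open>conf\<close> occur only while \<open>settled\<close> is empty; from
  Phase 2 on, only a selection changes it, by adding an index.\<close>

lemma settled_mono_step:
  assumes "search_step W I cand c K B s s'"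
  shows "settled s \<subseteq> settled s'"
  using assms by cases (auto simp: settled_def split: stage.splits)

lemma settled_mono_run:
  assumes "(search_step W I cand c K B)\<^sup>*\<^sup>* s s'"
  shows "settled s \<subseteq> settled s'"
  using assms by induction (auto dest: settled_mono_step)

locale two_phase_search = what_if_costs W I c
  for W :: "'q set" and I :: "'i set" and c :: "'q \<Rightarrow> 'i set \<Rightarrow> real" +
  fixes cand :: "'q \<Rightarrow> 'i set" and K :: nat
  assumes cand_subset: "\<And>q. q \<in> W \<Longrightarrow> cand q \<subseteq> I"
begin

text \<open>The inclusions keep every selectable index in \<open>I\<close>; the cardinality clause
  lets the final configuration compete with the simulated choice.\<close>

definition search_invariant :: "('q, 'i) search_state \<Rightarrow> bool" where
  "search_invariant s \<longleftrightarrow>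
     todo s \<subseteq> W \<and> scope W s \<subseteq> W \<and> pool s \<subseteq> I \<and> conf s \<subseteq> I \<and> card (conf s) \<le> K \<and>
     valid_bounds (settled s) (bound s)"

lemma remaining_subset:
  "search_invariant s \<Longrightarrow> remaining cand s \<subseteq> I - conf s"
  using cand_subset
  by (auto simp: search_invariant_def remaining_def scope_def split: stage.splits)

lemma search_invariant_initial: "search_invariant (initial_state W I c)"
  using valid_bounds_initial
  by (simp add: search_invariant_def initial_state_def scope_def settled_def)

lemma search_invariant_update_bounds:
  assumes "search_invariant s"
  shows "search_invariant (update_bounds W I c K s)"
proof -
  have "scope W (update_bounds W I c K s) = scope W s"
    by (simp add: scope_def)
  \<comment> \<open>\<open>settled s\<close> is empty in a \<open>Query_Search\<close> and equals
    \<open>conf s\<close> in a \<open>Workload_Search\<close>, as the two update lemmas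
    require.\<close>
  moreover have "valid_bounds (settled s) (bound (update_bounds W I c K s))"
    using assms valid_bounds_phase1_update valid_bounds_phase2_update
    by (auto simp: search_invariant_def update_bounds_def settled_def split: stage.splits)
  ultimately show ?thesis
    using assms by (simp add: search_invariant_def)
qed

lemma search_invariant_step:
  assumes "search_step W I cand c K B s s'" "search_invariant s"
  shows "search_invariant s'"
  using assms(1)
proof cases
  case (start_query q)
  then show ?thesis
    using assms(2) by (auto simp: search_invariant_def scope_def settled_def)
next
  case (what_if_call z q)
  have "search_invariant (s\<lparr>calls := insert (q, conf s \<union> {z}) (calls s)\<rparr>)"
    using assms(2) unfolding search_invariant_def scope_def settled_def by (cases "stage s") auto
  then show ?thesis
    using what_if_call search_invariant_update_bounds by simp
next
  case (select z)
  have z: "z \<in> I" "z \<notin> conf s"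
    using select remaining_subset[OF assms(2)] by auto
  have "stage s \<noteq> Finished"
    using select by (auto simp: remaining_def)
  \<comment> \<open>In Phase 1 \<open>settled\<close> stays empty; in Phase 2 it gains
    \<open>z\<close> while the bounds are still the old ones.\<close>
  then have "valid_bounds (settled (s\<lparr>conf := conf s \<union> {z}\<rparr>)) (bound s)"
    using assms(2) z valid_bounds_insert[of "conf s" "bound s" z]
    by (auto simp: search_invariant_def settled_def split: stage.splits)
  moreover have "card (conf s \<union> {z}) \<le> K"
    using select card_insert_le_m1[of K "conf s" z] by simp
  ultimately have "search_invariant (s\<lparr>conf := conf s \<union> {z}\<rparr>)"
    using assms(2) z by (simp add: search_invariant_def scope_def)
  then show ?thesis
    using select search_invariant_update_bounds by simp
next
  case (finish_query q)
  then show ?thesis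
    using assms(2) by (auto simp: search_invariant_def scope_def settled_def)
next
  case start_workload
  then have "search_invariant (s\<lparr>stage := Workload_Search, conf := {}\<rparr>)"
    using assms(2) by (simp add: search_invariant_def scope_def settled_def)
  then show ?thesis
    using start_workload search_invariant_update_bounds by simp
next
  case finish_workload
  then show ?thesis
    using assms(2) by (simp add: search_invariant_def scope_def settled_def)
qed

lemma search_invariant_run:
  assumes "(search_step W I cand c K B)\<^sup>*\<^sup>* s s'" "search_invariant s"
  shows "search_invariant s'"
  using assms by induction (auto dest: search_invariant_step)

end

theorem theorem2:
  fixes W :: "'q set" and I :: "'i set"
    and cand :: "'q \<Rightarrow> 'i set" and c :: "'q \<Rightarrow> 'i set \<Rightarrow> real"
    and K B t :: nat
    and s s_end :: "('q, 'i) search_state" and zs :: "'i list"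
  assumes "finite W" and "finite I"
    and "\<And>q. q \<in> W \<Longrightarrow> cand q \<subseteq> I"
    and nonneg: "\<And>q C. q \<in> W \<Longrightarrow> C \<subseteq> I \<Longrightarrow> 0 \<le> c q C"
    and monotone: "\<And>q C1 C2. q \<in> W \<Longrightarrow> C1 \<subseteq> C2 \<Longrightarrow> C2 \<subseteq> I \<Longrightarrow> c q C2 \<le> c q C1"
    and submodular: "\<And>q X Y z. q \<in> W \<Longrightarrow> X \<subseteq> Y \<Longrightarrow> Y \<subseteq> I \<Longrightarrow> z \<in> I \<Longrightarrow> z \<notin> Y \<Longrightarrow>
           c q Y - c q (Y \<union> {z}) \<le> c q X - c q (X \<union> {z})"
    and run_to_t: "(search_step W I cand c K B)\<^sup>*\<^sup>* (initial_state W I c) s"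
    and t_calls: "card (calls s) = t" and "t < B"
    and run_to_end: "(search_step W I cand c K B)\<^sup>*\<^sup>* s s_end" and finished: "stage s_end = Finished"
    and simulated: "complete_simulation W I K (bound s) zs"
  shows "cost_lower_bound W c K (bound s) zs \<le> workload_cost c W (conf s_end)"
proof -
  interpret two_phase_search W I c cand K
    using assms by unfold_locales auto
  have inv: "search_invariant s"
    using search_invariant_run[OF run_to_t search_invariant_initial] .
  then have "search_invariant s_end"
    using search_invariant_run[OF run_to_end] by blast
  then have conf_end: "conf s_end \<subseteq> I" "card (conf s_end) \<le> K"
    by (auto simp: search_invariant_def)
  \<comment> \<open>This covers both phases at once: if \<open>s\<close> lies in Phase 1, the left
    side is empty.\<close>
  have settled: "settled s \<subseteq> conf s_end"
    using settled_mono_run[OF run_to_end] finished by (simp add: settled_def)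
  have "workload_cost c W {} - workload_cost c W (conf s_end)
      = (\<Sum>q\<in>W. c q {} - c q (conf s_end))"
    by (simp add: workload_cost_def sum_subtractf)
  \<comment> \<open>The bounds stay those of \<open>s\<close>, although the configuration is that of
    \<open>s_end\<close>.\<close>
  also have "\<dots> \<le> (\<Sum>q\<in>W. \<Sum>z\<in>conf s_end. bound s q z)"
    using inv settled conf_end
    by (intro sum_mono valid_bounds_improvement_le) (auto simp: search_invariant_def)
  also have "\<dots> = sum (workload_bound W (bound s)) (conf s_end)"
    unfolding workload_bound_def by (rule sum.swap)
  also have "\<dots> \<le> sum (workload_bound W (bound s)) (set zs)"
    using complete_simulation_maximal[OF simulated \<open>finite I\<close> conf_end] .
  also have "\<dots> = (\<Sum>j=1..K. simulation_value W (bound s) zs j)"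
    using simulated sum_simulation_value by (metis complete_simulation_def)
  finally show ?thesis
    by (simp add: cost_lower_bound_def)
qed

end
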